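(* Let $x\in\mathcal{B}^n$ and $x\notin\mathcal{D}_n$. Then there exists a closed max-min convex set $C\subseteq\mathcal{B}^n$ with $x\notin C$ such that $x$ cannot be separated from $C$ by a max-min hyperplane, i.e. every max-min hyperplane containing $C$ also contains $x$.
   Context: Let $n\ge 1$ and $\mathcal{B}=[0,1]$ with operations $\oplus=\max$ and $\wedge=\min$ ($\wedge$ has priority over $\oplus$). On $\mathcal{B}^n$, $(x\oplus y)_i=x_i\oplus y_i$ and, for a scalar $a\in\mathcal{B}$, $(a\wedge x)_i=a\wedge x_i$. Topological notions are those of $[0,1]^n\subset\mathbb{R}^n$. A subset $C\subseteq\mathcal{B}^n$ is max-min convex if $x,y\in C$, $\alpha,\beta\in\mathcal{B}$, $\alpha\oplus\beta=1$ imply $\alpha\wedge x\oplus\beta\wedge y\in C$. The diagonal of $\mathcal{B}^n$ is $\mathcal{D}_n=\{(a,\ldots,a)\mid a\in\mathcal{B}\}$. A max-min hyperplane is the set of all $x=(x_1,\ldots,x_n)\in\mathcal{B}^n$ satisfying an equation of the form $$a_1\wedge x_1\oplus\cdots\oplus a_n\wedge x_n\oplus a_{n+1}=b_1\wedge x_1\oplus\cdots\oplus b_n\wedge x_n\oplus b_{n+1},$$ with $a_k,b_k\in\mathcal{B}$ for $k=1,\ldots,n+1$, where each side contains at least one term (omitting a term amounts to its coefficient being $0$). A point $x$ is separated from a set $C$ by a hyperplane $H$ if $C\subseteq H$ and $x\notin H$. *)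

theory Defs
  imports "HOL-Analysis.Analysis"
begin

definition mm_scalars :: "real set" where
  "mm_scalars = {0..1}"

definition mm_space :: "(real ^ 'n) set" where
  "mm_space = {x. \<forall>i. x $ i \<in> mm_scalars}"

definition mm_plus :: "real ^ 'n \<Rightarrow> real ^ 'n \<Rightarrow> real ^ 'n" where
  "mm_plus x y = (\<chi> i. max (x $ i) (y $ i))"

definition mm_scale :: "real \<Rightarrow> real ^ 'n \<Rightarrow> real ^ 'n" where
  "mm_scale a x = (\<chi> i. min a (x $ i))"

definition mm_convex :: "(real ^ 'n) set \<Rightarrow> bool" where
  "mm_convex C \<longleftrightarrow>
     C \<subseteq> mm_space \<and>
     (\<forall>x\<in>C. \<forall>y\<in>C. \<forall>\<alpha>\<in>mm_scalars. \<forall>\<beta>\<in>mm_scalars.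
        max \<alpha> \<beta> = 1 \<longrightarrow> mm_plus (mm_scale \<alpha> x) (mm_scale \<beta> y) \<in> C)"

definition mm_diagonal :: "(real ^ 'n) set" where
  "mm_diagonal = {(\<chi> i. a) | a. a \<in> mm_scalars}"

text \<open>The constant term \<open>a\<^sub>n\<^sub>+\<^sub>1\<close> of an affine max-min form is the separate argument \<open>c\<close>.
  Omitted terms are those with coefficient \<open>0\<close>, the neutral element of \<open>max\<close> on \<open>[0,1]\<close>.\<close>

definition mm_form :: "real ^ 'n \<Rightarrow> real \<Rightarrow> real ^ 'n \<Rightarrow> real" where
  "mm_form a c x = max (Max (range (\<lambda>i. min (a $ i) (x $ i)))) c"

definition mm_hyperplane :: "(real ^ 'n) set \<Rightarrow> bool" where
  "mm_hyperplane H \<longleftrightarrow>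
     (\<exists>a\<in>mm_space. \<exists>b\<in>mm_space. \<exists>c\<in>mm_scalars. \<exists>d\<in>mm_scalars.
        H = {x \<in> mm_space. mm_form a c x = mm_form b d x})"

definition mm_separates :: "(real ^ 'n) set \<Rightarrow> real ^ 'n \<Rightarrow> (real ^ 'n) set \<Rightarrow> bool" where
  "mm_separates H x C \<longleftrightarrow> C \<subseteq> H \<and> x \<notin> H"

end

theory Submission
  imports Defs
begin

text \<open>
  Choose a level \<open>m\<close> strictly between the smallest and the largest coordinate of \<open>x\<close>, which is
  possible exactly because \<open>x\<close> is off the diagonal, and split \<open>x\<close> at that level into
  \<open>u = m \<and> x\<close> and \<open>v = m \<oplus> x\<close>. The set \<open>C\<close> is the max-min segment from \<open>u\<close> to \<open>v\<close>.

  Cutting with \<open>m\<close> from above or from below is an idempotent endomorphism of the distributive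
  lattice \<open>[0,1]\<close>, and a max-min form \<open>f\<close> is a lattice polynomial; cutting its value makes a
  preceding cut of its arguments invisible, whatever its coefficients are. Hence \<open>f u\<close> determines the part
  \<open>m \<and> f x\<close> and \<open>f v\<close> determines the part \<open>m \<oplus> f x\<close>
  (\<open>mm_form_cut_above\<close>, \<open>mm_form_cut_below\<close>). If two forms agree at \<open>u\<close> and \<open>v\<close>,
  then their values at \<open>x\<close> have the same meet and the same join with \<open>m\<close>, so they are equal by
  cancellation. Thus every hyperplane through \<open>u\<close> and \<open>v\<close> passes through \<open>x\<close>.

  The segment itself misses \<open>x\<close>: moving from \<open>u\<close> to \<open>v\<close> it must first raise all the coordinates
  that are below \<open>m\<close> up to \<open>m\<close>, reaching the diagonal, before it raises any coordinate above \<open>m\<close>.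
\<close>

lemma mm_form_le_iff:
  fixes a x :: "real ^ 'n"
  shows "mm_form a c x \<le> t \<longleftrightarrow> c \<le> t \<and> (\<forall>i. min (a $ i) (x $ i) \<le> t)"
  unfolding mm_form_def by (auto simp: Max_le_iff)

text \<open>Both cut lemmas compare the upper bounds of the two sides, which avoids moving a lattice
  homomorphism through the finite maximum.\<close>

lemma mm_form_cut_above:
  "min m (mm_form a c (mm_scale m x)) = min m (mm_form a c x)"
proof -
  have "min m (mm_form a c (mm_scale m x)) \<le> t \<longleftrightarrow> min m (mm_form a c x) \<le> t" for t
    by (auto simp: min_le_iff_disj mm_form_le_iff mm_scale_def)
  then show ?thesis
    by (meson order_antisym order_refl)
qed

lemma mm_form_cut_below:
  "max m (mm_form a c (mm_plus (\<chi> i. m) x)) = max m (mm_form a c x)"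
proof -
  have "max m (mm_form a c (mm_plus (\<chi> i. m) x)) \<le> t \<longleftrightarrow> max m (mm_form a c x) \<le> t" for t
    by (auto simp: min_le_iff_disj mm_form_le_iff mm_plus_def)
  then show ?thesis
    by (meson order_antisym order_refl)
qed

lemma min_max_cancel:
  fixes p q m :: "'a::linorder"
  assumes "min m p = min m q" and "max m p = max m q"
  shows "p = q"
  using assms by (metis max_def min_def)

lemma mm_hyperplane_mem_of_cuts:
  assumes "mm_hyperplane H" and "x \<in> mm_space"
    and "mm_scale m x \<in> H" and "mm_plus (\<chi> i. m) x \<in> H"
  shows "x \<in> H"
proof -
  obtain a b c d where H: "H = {x \<in> mm_space. mm_form a c x = mm_form b d x}"
    using assms(1) unfolding mm_hyperplane_def by blast
  have "min m (mm_form a c x) = min m (mm_form b d x)"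
    using assms(3) mm_form_cut_above[of m a c x] mm_form_cut_above[of m b d x] by (simp add: H)
  moreover have "max m (mm_form a c x) = max m (mm_form b d x)"
    using assms(4) mm_form_cut_below[of m a c x] mm_form_cut_below[of m b d x] by (simp add: H)
  ultimately have "mm_form a c x = mm_form b d x"
    by (rule min_max_cancel)
  then show ?thesis
    using assms(2) by (simp add: H)
qed

text \<open>Since \<open>\<alpha> \<oplus> \<beta> = 1\<close> forces one of the two coefficients to be \<open>1\<close>, the segment between
  comparable points \<open>u \<le> v\<close> needs only one parameter: the points with \<open>\<beta> = 1\<close> all equal \<open>v\<close>.\<close>

definition mm_segment :: "real ^ 'n \<Rightarrow> real ^ 'n \<Rightarrow> (real ^ 'n) set" where
  "mm_segment u v = (\<lambda>\<beta>. mm_plus u (mm_scale \<beta> v)) ` mm_scalars"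

lemma mm_segment_subset_space:
  assumes "u \<in> mm_space" and "v \<in> mm_space"
  shows "mm_segment u v \<subseteq> mm_space"
  using assms
  by (auto simp: mm_segment_def mm_space_def mm_scalars_def mm_plus_def mm_scale_def
      le_max_iff_disj min_le_iff_disj)

lemma closed_mm_segment: "closed (mm_segment u v)"
proof -
  have "continuous_on mm_scalars (\<lambda>\<beta>. mm_plus u (mm_scale \<beta> v))"
    unfolding mm_plus_def mm_scale_def
    by (intro continuous_intros)
  then have "compact (mm_segment u v)"
    unfolding mm_segment_def
    by (rule compact_continuous_image) (simp add: mm_scalars_def)
  then show ?thesis
    by (rule compact_imp_closed)
qed

lemma mm_convex_segment:
  assumes "u \<in> mm_space" and "v \<in> mm_space"
  shows "mm_convex (mm_segment u v)"
  unfolding mm_convex_def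
proof (intro conjI ballI impI mm_segment_subset_space[OF assms])
  fix y z \<alpha> \<beta>
  assume "y \<in> mm_segment u v" and "z \<in> mm_segment u v"
    and scalars: "\<alpha> \<in> mm_scalars" "\<beta> \<in> mm_scalars" and one: "max \<alpha> \<beta> = 1"
  then obtain s t where s: "s \<in> mm_scalars" "y = mm_plus u (mm_scale s v)"
    and t: "t \<in> mm_scalars" "z = mm_plus u (mm_scale t v)"
    by (auto simp: mm_segment_def)
  \<comment> \<open>By distributivity \<open>u\<close> receives the coefficient \<open>\<alpha> \<oplus> \<beta> = 1\<close>, which leaves it unchanged.\<close>
  define r where "r = max (min \<alpha> s) (min \<beta> t)"
  have "mm_plus (mm_scale \<alpha> y) (mm_scale \<beta> z) = mm_plus u (mm_scale r v)"
  proof (unfold vec_eq_iff, rule allI)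
    fix i
    have "u $ i \<le> 1"
      using assms(1) by (simp add: mm_space_def mm_scalars_def)
    then have absorb: "max (min \<alpha> (u $ i)) (min \<beta> (u $ i)) = u $ i"
      using one by (simp flip: min_max_distrib1)
    have "mm_plus (mm_scale \<alpha> y) (mm_scale \<beta> z) $ i
        = max (max (min \<alpha> (u $ i)) (min \<alpha> (min s (v $ i))))
              (max (min \<beta> (u $ i)) (min \<beta> (min t (v $ i))))"
      by (simp only: mm_plus_def mm_scale_def s(2) t(2) vec_lambda_beta min_max_distrib2)
    also have "\<dots> = max (max (min \<alpha> (u $ i)) (min \<beta> (u $ i)))
                       (max (min \<alpha> (min s (v $ i))) (min \<beta> (min t (v $ i))))"
      by (simp only: max.assoc max.left_commute)
    also have "\<dots> = max (u $ i) (min r (v $ i))"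
      by (simp only: absorb r_def min_max_distrib1 min.assoc)
    finally show "mm_plus (mm_scale \<alpha> y) (mm_scale \<beta> z) $ i = mm_plus u (mm_scale r v) $ i"
      by (simp add: mm_plus_def mm_scale_def)
  qed
  moreover have "r \<in> mm_scalars"
    using scalars s(1) t(1) by (auto simp: r_def mm_scalars_def le_max_iff_disj min_le_iff_disj)
  ultimately show "mm_plus (mm_scale \<alpha> y) (mm_scale \<beta> z) \<in> mm_segment u v"
    by (simp add: mm_segment_def)
qed

lemma mm_segment_endpoints:
  assumes "u \<in> mm_space" and "v \<in> mm_space" and le: "\<And>i. u $ i \<le> v $ i"
  shows "u \<in> mm_segment u v" and "v \<in> mm_segment u v"
proof -
  have "mm_plus u (mm_scale 0 v) = u"
    using assms by (simp add: vec_eq_iff mm_plus_def mm_scale_def mm_space_def mm_scalars_def)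
  then show "u \<in> mm_segment u v"
    unfolding mm_segment_def by (rule image_eqI[OF sym]) (simp add: mm_scalars_def)
  have "mm_plus u (mm_scale 1 v) = v"
    using assms by (simp add: vec_eq_iff mm_plus_def mm_scale_def mm_space_def mm_scalars_def)
  then show "v \<in> mm_segment u v"
    unfolding mm_segment_def by (rule image_eqI[OF sym]) (simp add: mm_scalars_def)
qed

text \<open>At a coordinate below the level, passing through \<open>x\<close> requires the parameter \<open>\<beta>\<close> to be
  still below \<open>m\<close>; at a coordinate above it, \<open>\<beta>\<close> must already exceed \<open>m\<close>.\<close>

lemma not_mem_mm_segment_cuts:
  assumes "x $ i < m" and "m < x $ j"
  shows "x \<notin> mm_segment (mm_scale m x) (mm_plus (\<chi> i. m) x)"
proof
  assume "x \<in> mm_segment (mm_scale m x) (mm_plus (\<chi> i. m) x)"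
  then obtain \<beta> where x: "x = mm_plus (mm_scale m x) (mm_scale \<beta> (mm_plus (\<chi> i. m) x))"
    by (auto simp: mm_segment_def)
  have coord: "x $ k = max (min m (x $ k)) (min \<beta> (max m (x $ k)))" for k
    using arg_cong[OF x, of "\<lambda>z. z $ k"] by (simp add: mm_plus_def mm_scale_def)
  from coord[of i] assms(1) have "\<beta> < m"
    by (auto simp: max_def min_def split: if_splits)
  moreover from coord[of j] assms(2) have "m < \<beta>"
    by (auto simp: max_def min_def split: if_splits)
  ultimately show False
    by simp
qed

lemma off_diagonal_coordinates:
  fixes x :: "real ^ 'n"
  assumes "x \<in> mm_space" and "x \<notin> mm_diagonal"
  obtains i j where "x $ i < x $ j"
proof (rule ccontr)
  assume "\<not> thesis"
  with that have "x $ i = x $ j" for i j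
    by (meson linorder_neqE)
  then have "x = (\<chi> i. x $ undefined)"
    by (simp add: vec_eq_iff)
  moreover have "x $ undefined \<in> mm_scalars"
    using assms(1) by (simp add: mm_space_def)
  ultimately have "x \<in> mm_diagonal"
    unfolding mm_diagonal_def by blast
  with assms(2) show False ..
qed

theorem corollary3p3:
  fixes x :: "real ^ 'n"
  assumes "x \<in> mm_space"
    and "x \<notin> mm_diagonal"
  shows "\<exists>C. C \<subseteq> mm_space \<and> closed C \<and> mm_convex C \<and> x \<notin> C \<and>
           \<not> (\<exists>H. mm_hyperplane H \<and> mm_separates H x C)"
proof -
  obtain i j where "x $ i < x $ j"
    using off_diagonal_coordinates[OF assms] .
  then obtain m where m: "x $ i < m" "m < x $ j"
    using dense by blast
  define u where "u = mm_scale m x"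
  define v where "v = mm_plus (\<chi> i. m) x"
  have coord: "0 \<le> x $ k" "x $ k \<le> 1" for k
    using assms(1) by (auto simp: mm_space_def mm_scalars_def)
  have "0 \<le> m" "m \<le> 1"
    using m coord[of i] coord[of j] by auto
  with coord have u: "u \<in> mm_space" and v: "v \<in> mm_space"
    by (auto simp: u_def v_def mm_space_def mm_scalars_def mm_scale_def mm_plus_def
        le_max_iff_disj min_le_iff_disj)
  have le: "u $ k \<le> v $ k" for k
    by (simp add: u_def v_def mm_scale_def mm_plus_def)
  have "x \<in> H" if "mm_hyperplane H" and "mm_segment u v \<subseteq> H" for H
    using mm_hyperplane_mem_of_cuts[OF that(1) assms(1), of m] that(2)
      mm_segment_endpoints[OF u v le] by (auto simp: u_def v_def)
  then have "\<not> (\<exists>H. mm_hyperplane H \<and> mm_separates H x (mm_segment u v))"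
    unfolding mm_separates_def by blast
  moreover have "x \<notin> mm_segment u v"
    unfolding u_def v_def using m by (rule not_mem_mm_segment_cuts)
  ultimately show ?thesis
    using mm_segment_subset_space[OF u v] closed_mm_segment mm_convex_segment[OF u v] by blast
qed

end
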